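(* Let $G=(Q,\Sigma,\delta,q_0,Q_m)$ be a plant, let $S=(X,\Sigma,\zeta,x_0)$ be a supervisor over a control constraint $\mathcal{C}=(\Sigma_c,\Sigma_o)$, and let $\Sigma_{s,A}\subseteq\Sigma_o$ be the set of observable events compromised under sensor attacks. Then the attacked monitor $M^A$ is language equivalent to $P_{\mathcal{C}}(G)^{\#}\lVert BT(S)^{A,loop}$, i.e. $L(M^A)=L(P_{\mathcal{C}}(G)^{\#}\lVert BT(S)^{A,loop})$.
   Context: **Automata.** A finite state automaton is a tuple $(Q,\Sigma,\delta,q_0,Q_m)$ with finite state set $Q$, finite alphabet $\Sigma$, partial (deterministic) transition function $\delta:Q\times\Sigma\to Q$, initial state $q_0$, and marked states $Q_m\subseteq Q$; $\delta$ is extended to $Q\times\Sigma^*$ as usual. $\delta(q,\sigma)!$ means $\delta(q,\sigma)$ is defined. $L(G)$ is the closed behavior (the set of strings $s\in\Sigma^*$ with $\delta(q_0,s)!$). If $Q_m$ is omitted, all states are marked (markings of $G$ are ignored here). For $Q'\subseteq Q$, $\delta(Q',\sigma)=\{\delta(q,\sigma)\mid q\in Q',\ \delta(q,\sigma)!\}$. $\lVert$ is the usual synchronous product (shared events are synchronized, private events interleave; the alphabet is the union). For $\Sigma''\subseteq\Sigma$, the unobservable reach is $UR_{G,\Sigma''}(q)=\{\delta(q,s)\mid s\in(\Sigma'')^*,\ \delta(q,s)!\}$ and $UR_{G,\Sigma''}(Q')=\bigcup_{q\in Q'}UR_{G,\Sigma''}(q)$. For $\Sigma'\subseteq\Sigma$,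 $P_{\Sigma'}(G)$ is the automaton $(2^Q,\Sigma,\Delta,UR_{G,\Sigma-\Sigma'}(q_0))$ over $\Sigma$ where, for $\varnothing\ne Q'\subseteq Q$: $\Delta(Q',\sigma)=UR_{G,\Sigma-\Sigma'}(\delta(Q',\sigma))$ if $\sigma\in\Sigma'$ (possibly $\varnothing$), and $\Delta(Q',\sigma)=Q'$ if $\sigma\in\Sigma-\Sigma'$; no transition is defined at the state $\varnothing$. **Supervisor.** $\Sigma_c,\Sigma_o\subseteq\Sigma$; $\Sigma_{uc}=\Sigma-\Sigma_c$, $\Sigma_{uo}=\Sigma-\Sigma_o$. A supervisor over $\mathcal{C}=(\Sigma_c,\Sigma_o)$ is a finite automaton $S=(X,\Sigma,\zeta,x_0)$ such that for every $x\in X$: $\zeta(x,\sigma)!$ for all $\sigma\in\Sigma_{uc}$; and for all $\sigma\in\Sigma_{uo}$, $\zeta(x,\sigma)!$ implies $\zeta(x,\sigma)=x$. Let $\Gamma=\{\gamma\subseteq\Sigma\mid\gamma\supseteq\Sigma_{uc}\}$ (control commands, used as event symbols disjoint from $\Sigma$) and $\Gamma(x)=\{\sigma\in\Sigma\mid\zeta(x,\sigma)!\}\in\Gamma$. $X_{com}=\{x_{com}\mid x\in X\}$ is a relabelled copy of $X$ disjoint from $X$; $x_{detect}\notin X\cup X_{com}$. $\Sigma_{s,A}^{\#}=\{\sigma^{\#}\mid\sigma\in\Sigma_{s,A}\}$ is a relabelled copy of $\Sigma_{s,A}$, disjoint from $\Sigma\cup\Gamma$. **$BT(S)$** $=(X\cup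 X_{com},\Sigma\cup\Gamma,\zeta^{BT},x_{0,com})$, with transitions (defined only when the right-hand side is): for $x\in X$, $\zeta^{BT}(x_{com},\Gamma(x))=x$; $\zeta^{BT}(x,\sigma)=\zeta(x,\sigma)$ for $\sigma\in\Sigma_{uo}$; $\zeta^{BT}(x,\sigma)=\zeta(x,\sigma)_{com}$ for $\sigma\in\Sigma_o$. **Monitor.** $M=P_{\Sigma_o\cup\Gamma}(G\lVert BT(S))=(2^{Q\times(X\cup X_{com})},\Sigma\cup\Gamma,\Lambda,\{(q_0,x_{0,com})\})$ (here $G\lVert BT(S)$ has alphabet $\Sigma\cup\Gamma$, and the unobservable events are $\Sigma_{uo}$). **Attacked monitor.** $M^A=(2^{Q\times(X\cup X_{com})},\Sigma_{s,A}^{\#}\cup\Sigma\cup\Gamma,\Lambda^A,\{(q_0,x_{0,com})\})$ where, for $D\subseteq Q\times(X\cup X_{com})$: (1) $\Lambda^A(D,\sigma)=\Lambda(D,\sigma)$ for $\sigma\in(\Sigma-\Sigma_{s,A})\cup\Gamma$; (2) $\Lambda^A(D,\sigma^{\#})=\Lambda(D,\sigma)$ for $\sigma\in\Sigma_{s,A}$; (3) $\Lambda^A(D,\sigma)=D$ for $D\ne\varnothing$, $\sigma\in\Sigma_{s,A}$. (No transition is defined at $\varnothing$.) **Relabelled $\mathcal{C}$-abstraction of $G$.** $P_{\mathcal{C}}(G)^{\#}=(2^Q,\Sigma_{s,A}^{\#}\cup\Sigma\cup\Gamma,\Delta_{\mathcal{C}}^{\#},\{q_0\})$ where, for $\varnothing\ne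 V\subseteq Q$: (1) $\Delta_{\mathcal{C}}^{\#}(V,\gamma)=UR_{G,\gamma\cap\Sigma_{uo}}(V)$ for $\gamma\in\Gamma$; (2) $\Delta_{\mathcal{C}}^{\#}(V,\sigma)=\delta(V,\sigma)$ for $\sigma\in\Sigma_o-\Sigma_{s,A}$; (3) $\Delta_{\mathcal{C}}^{\#}(V,\sigma^{\#})=\delta(V,\sigma)$ for $\sigma\in\Sigma_{s,A}$; (4) $\Delta_{\mathcal{C}}^{\#}(V,\sigma)=V$ for $\sigma\in\Sigma_{s,A}\cup\Sigma_{uo}$. No transition is defined at the state $\varnothing$. **$BT(S)^{A,loop}$** $=(X\cup X_{com}\cup\{x_{detect}\},\Sigma_{s,A}^{\#}\cup\Sigma\cup\Gamma,\zeta^{BT,A,loop},x_{0,com})$, writing $\zeta^{l}$ for $\zeta^{BT,A,loop}$, with exactly the following transitions: 1. $\zeta^{l}(x_{com},\Gamma(x))=x$ for $x\in X$; 2. for $x\in X$, $\sigma\in\Sigma_o-\Sigma_{s,A}$ with $\zeta(x,\sigma)!$: $\zeta^{l}(x,\sigma)=\zeta(x,\sigma)_{com}$; 3. for $x\in X$, $\sigma\in\Sigma_{s,A}$ with $\zeta(x,\sigma)!$: $\zeta^{l}(x,\sigma^{\#})=\zeta(x,\sigma)_{com}$; 4. for $x\in X$, $\sigma\in\Sigma_o-\Sigma_{s,A}$ with $\neg\zeta(x,\sigma)!$: $\zeta^{l}(x,\sigma)=x_{detect}$; 5. for $x\in X$, $\sigma\in\Sigma_{s,A}$ with $\neg\zeta(x,\sigma)!$: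 $\zeta^{l}(x,\sigma^{\#})=x_{detect}$; 6. for $x\in X\cup X_{com}$, $\sigma\in\Sigma_{s,A}\cup\Sigma_{uo}$: $\zeta^{l}(x,\sigma)=x$; 7. for $x\in X$, $\gamma\in\Gamma$, $\gamma\ne\Gamma(x)$: $\zeta^{l}(x_{com},\gamma)=x_{detect}$; 8. for $x\in X$, $\sigma\in\Sigma_o-\Sigma_{s,A}$: $\zeta^{l}(x_{com},\sigma)=x_{detect}$; 9. for $x\in X$, $\sigma\in\Sigma_{s,A}$: $\zeta^{l}(x_{com},\sigma^{\#})=x_{detect}$; 10. for $x\in X$, $\gamma\in\Gamma$: $\zeta^{l}(x,\gamma)=x_{detect}$. *)

theory Defs
  imports Main
begin

record ('s, 'e) automaton =
  states :: "'s set"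
  alphabet :: "'e set"
  delta :: "'s \<Rightarrow> 'e \<Rightarrow> 's option"
  init :: "'s"
  marked :: "'s set"

text \<open>
  \<open>delta A q e = None\<close> encodes that the transition is undefined. It is required to be undefined
  outside the carriers, so that \<open>delta\<close> is a partial function on \<open>states \<times> alphabet\<close>.
\<close>

definition finite_automaton :: "('s, 'e) automaton \<Rightarrow> bool" where
  "finite_automaton A \<longleftrightarrow>
     finite (states A) \<and> finite (alphabet A) \<and>
     init A \<in> states A \<and> marked A \<subseteq> states A \<and>
     (\<forall>q e q'. delta A q e = Some q' \<longrightarrow> q \<in> states A \<and> e \<in> alphabet A \<and> q' \<in> states A)"

fun delta_star :: "('s, 'e) automaton \<Rightarrow> 's \<Rightarrow> 'e list \<Rightarrow> 's option" where
  "delta_star A q [] = Some q"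
| "delta_star A q (e # s) =
     (case delta A q e of None \<Rightarrow> None | Some q' \<Rightarrow> delta_star A q' s)"

definition closed_behavior :: "('s, 'e) automaton \<Rightarrow> 'e list set" where
  "closed_behavior A = {s \<in> lists (alphabet A). delta_star A (init A) s \<noteq> None}"

definition delta_set :: "('s, 'e) automaton \<Rightarrow> 's set \<Rightarrow> 'e \<Rightarrow> 's set" where
  "delta_set A V e = {q'. \<exists>q\<in>V. delta A q e = Some q'}"

definition unobs_reach :: "('s, 'e) automaton \<Rightarrow> 'e set \<Rightarrow> 's \<Rightarrow> 's set" where
  "unobs_reach A U q = {q'. \<exists>s\<in>lists U. delta_star A q s = Some q'}"

definition unobs_reach_set :: "('s, 'e) automaton \<Rightarrow> 'e set \<Rightarrow> 's set \<Rightarrow> 's set" where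
  "unobs_reach_set A U V = (\<Union>q\<in>V. unobs_reach A U q)"

definition sync_prod ::
  "('s, 'e) automaton \<Rightarrow> ('t, 'e) automaton \<Rightarrow> ('s \<times> 't, 'e) automaton" where
  "sync_prod A B =
     \<lparr>states = states A \<times> states B,
      alphabet = alphabet A \<union> alphabet B,
      delta = (\<lambda>(p, q) e.
        if p \<notin> states A \<or> q \<notin> states B then None
        else if e \<in> alphabet A \<inter> alphabet B then
          (case (delta A p e, delta B q e) of
             (Some p', Some q') \<Rightarrow> Some (p', q')
           | _ \<Rightarrow> None)
        else if e \<in> alphabet A then map_option (\<lambda>p'. (p', q)) (delta A p e)
        else if e \<in> alphabet B then map_option (\<lambda>q'. (p, q')) (delta B q e)
        else None),
      init = (init A, init B),
      marked = marked A \<times> marked B\<rparr>"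

text \<open>
  The observation automaton of \<open>A\<close> for the observable events \<open>Obs\<close>. The state \<open>{}\<close> can be
  reached (by an observable event) but has no outgoing transition.
\<close>

definition observer :: "'e set \<Rightarrow> ('s, 'e) automaton \<Rightarrow> ('s set, 'e) automaton" where
  "observer Obs A =
     \<lparr>states = Pow (states A),
      alphabet = alphabet A,
      delta = (\<lambda>V e.
        if V = {} \<or> \<not> V \<subseteq> states A \<or> e \<notin> alphabet A then None
        else if e \<in> Obs then Some (unobs_reach_set A (alphabet A - Obs) (delta_set A V e))
        else Some V),
      init = unobs_reach A (alphabet A - Obs) (init A),
      marked = Pow (states A)\<rparr>"

definition control_commands :: "'e set \<Rightarrow> 'e set \<Rightarrow> 'e set set" where
  "control_commands \<Sigma> \<Sigma>c = {\<gamma>. \<gamma> \<subseteq> \<Sigma> \<and> \<Sigma> - \<Sigma>c \<subseteq> \<gamma>}"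

definition enabled :: "('x, 'e) automaton \<Rightarrow> 'x \<Rightarrow> 'e set" where
  "enabled S x = {\<sigma> \<in> alphabet S. delta S x \<sigma> \<noteq> None}"

text \<open>A supervisor is given without marking, i.e. all of its states are marked.\<close>

definition supervisor :: "'e set \<Rightarrow> 'e set \<Rightarrow> 'e set \<Rightarrow> ('x, 'e) automaton \<Rightarrow> bool" where
  "supervisor \<Sigma> \<Sigma>c \<Sigma>o S \<longleftrightarrow>
     finite_automaton S \<and> alphabet S = \<Sigma> \<and> marked S = states S \<and>
     (\<forall>x\<in>states S. \<forall>\<sigma>\<in>\<Sigma> - \<Sigma>c. delta S x \<sigma> \<noteq> None) \<and>
     (\<forall>x\<in>states S. \<forall>\<sigma>\<in>\<Sigma> - \<Sigma>o. delta S x \<sigma> \<noteq> None \<longrightarrow> delta S x \<sigma> = Some x)"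

text \<open>
  The disjoint copies: \<open>Ev\<close> embeds \<open>\<Sigma>\<close>, \<open>Hash\<close> is the relabelling \<open>\<sigma> \<mapsto> \<sigma>\<close>-sharp
  of the compromised events, \<open>Cmd\<close> turns a control command into an event symbol.
\<close>

datatype 'e event = Ev 'e | Hash 'e | Cmd "'e set"

datatype 'x bt_state = Exec 'x | Com 'x | Detect

text \<open>\<open>G\<close> itself, with every \<open>\<sigma>\<close> written as \<open>Ev \<sigma>\<close>; the alphabet is still (the copy of) \<open>\<Sigma>\<close>.\<close>

definition embed :: "('s, 'e) automaton \<Rightarrow> ('s, 'e event) automaton" where
  "embed A =
     \<lparr>states = states A,
      alphabet = Ev ` alphabet A,
      delta = (\<lambda>q e. case e of Ev \<sigma> \<Rightarrow> delta A q \<sigma> | _ \<Rightarrow> None),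
      init = init A,
      marked = marked A\<rparr>"

definition attack_alphabet :: "'e set \<Rightarrow> 'e set \<Rightarrow> 'e set \<Rightarrow> 'e event set" where
  "attack_alphabet \<Sigma> \<Sigma>c \<Sigma>sA = Hash ` \<Sigma>sA \<union> Ev ` \<Sigma> \<union> Cmd ` control_commands \<Sigma> \<Sigma>c"

fun bt_delta ::
  "'e set \<Rightarrow> ('x, 'e) automaton \<Rightarrow> 'x bt_state \<Rightarrow> 'e event \<Rightarrow> 'x bt_state option" where
  "bt_delta \<Sigma>o S (Com x) (Cmd \<gamma>) =
     (if x \<in> states S \<and> \<gamma> = enabled S x then Some (Exec x) else None)"
| "bt_delta \<Sigma>o S (Exec x) (Ev \<sigma>) =
     (if x \<notin> states S \<or> \<sigma> \<notin> alphabet S then None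
      else if \<sigma> \<in> \<Sigma>o then map_option Com (delta S x \<sigma>)
      else map_option Exec (delta S x \<sigma>))"
| "bt_delta \<Sigma>o S _ _ = None"

definition BT ::
  "'e set \<Rightarrow> 'e set \<Rightarrow> ('x, 'e) automaton \<Rightarrow> ('x bt_state, 'e event) automaton" where
  "BT \<Sigma>c \<Sigma>o S =
     \<lparr>states = Exec ` states S \<union> Com ` states S,
      alphabet = Ev ` alphabet S \<union> Cmd ` control_commands (alphabet S) \<Sigma>c,
      delta = bt_delta \<Sigma>o S,
      init = Com (init S),
      marked = Exec ` states S \<union> Com ` states S\<rparr>"

definition monitor ::
  "'e set \<Rightarrow> 'e set \<Rightarrow> ('q, 'e) automaton \<Rightarrow> ('x, 'e) automaton
   \<Rightarrow> (('q \<times> 'x bt_state) set, 'e event) automaton" where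
  "monitor \<Sigma>c \<Sigma>o G S =
     observer (Ev ` \<Sigma>o \<union> Cmd ` control_commands (alphabet G) \<Sigma>c)
       (sync_prod (embed G) (BT \<Sigma>c \<Sigma>o S))"

definition attacked_monitor ::
  "'e set \<Rightarrow> 'e set \<Rightarrow> 'e set \<Rightarrow> ('q, 'e) automaton \<Rightarrow> ('x, 'e) automaton
   \<Rightarrow> (('q \<times> 'x bt_state) set, 'e event) automaton" where
  "attacked_monitor \<Sigma>c \<Sigma>o \<Sigma>sA G S =
     (let M = monitor \<Sigma>c \<Sigma>o G S in
     \<lparr>states = states M,
      alphabet = attack_alphabet (alphabet G) \<Sigma>c \<Sigma>sA,
      delta = (\<lambda>D e. case e of
          Ev \<sigma> \<Rightarrow>
            if \<sigma> \<in> \<Sigma>sA then (if D \<in> states M \<and> D \<noteq> {} then Some D else None)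
            else delta M D (Ev \<sigma>)
        | Hash \<sigma> \<Rightarrow> if \<sigma> \<in> \<Sigma>sA then delta M D (Ev \<sigma>) else None
        | Cmd \<gamma> \<Rightarrow> delta M D (Cmd \<gamma>)),
      init = {(init G, Com (init S))},
      marked = states M\<rparr>)"

definition relabelled_abstraction ::
  "'e set \<Rightarrow> 'e set \<Rightarrow> 'e set \<Rightarrow> ('q, 'e) automaton \<Rightarrow> ('q set, 'e event) automaton" where
  "relabelled_abstraction \<Sigma>c \<Sigma>o \<Sigma>sA G =
     \<lparr>states = Pow (states G),
      alphabet = attack_alphabet (alphabet G) \<Sigma>c \<Sigma>sA,
      delta = (\<lambda>V e.
        if V = {} \<or> \<not> V \<subseteq> states G then None
        else (case e of
            Cmd \<gamma> \<Rightarrow>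
              if \<gamma> \<in> control_commands (alphabet G) \<Sigma>c
              then Some (unobs_reach_set G (\<gamma> \<inter> (alphabet G - \<Sigma>o)) V)
              else None
          | Ev \<sigma> \<Rightarrow>
              if \<sigma> \<in> \<Sigma>o - \<Sigma>sA then Some (delta_set G V \<sigma>)
              else if \<sigma> \<in> \<Sigma>sA \<union> (alphabet G - \<Sigma>o) then Some V
              else None
          | Hash \<sigma> \<Rightarrow> if \<sigma> \<in> \<Sigma>sA then Some (delta_set G V \<sigma>) else None)),
      init = {init G},
      marked = Pow (states G)\<rparr>"

fun bt_loop_delta ::
  "'e set \<Rightarrow> 'e set \<Rightarrow> 'e set \<Rightarrow> ('x, 'e) automaton
   \<Rightarrow> 'x bt_state \<Rightarrow> 'e event \<Rightarrow> 'x bt_state option" where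
  "bt_loop_delta \<Sigma>c \<Sigma>o \<Sigma>sA S (Com x) (Cmd \<gamma>) =
     (if x \<in> states S \<and> \<gamma> \<in> control_commands (alphabet S) \<Sigma>c
      then Some (if \<gamma> = enabled S x then Exec x else Detect)
      else None)"
| "bt_loop_delta \<Sigma>c \<Sigma>o \<Sigma>sA S (Com x) (Ev \<sigma>) =
     (if x \<notin> states S then None
      else if \<sigma> \<in> \<Sigma>sA \<union> (alphabet S - \<Sigma>o) then Some (Com x)
      else if \<sigma> \<in> \<Sigma>o - \<Sigma>sA then Some Detect
      else None)"
| "bt_loop_delta \<Sigma>c \<Sigma>o \<Sigma>sA S (Com x) (Hash \<sigma>) =
     (if x \<in> states S \<and> \<sigma> \<in> \<Sigma>sA then Some Detect else None)"
| "bt_loop_delta \<Sigma>c \<Sigma>o \<Sigma>sA S (Exec x) (Cmd \<gamma>) =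
     (if x \<in> states S \<and> \<gamma> \<in> control_commands (alphabet S) \<Sigma>c then Some Detect else None)"
| "bt_loop_delta \<Sigma>c \<Sigma>o \<Sigma>sA S (Exec x) (Ev \<sigma>) =
     (if x \<notin> states S then None
      else if \<sigma> \<in> \<Sigma>sA \<union> (alphabet S - \<Sigma>o) then Some (Exec x)
      else if \<sigma> \<in> \<Sigma>o - \<Sigma>sA then
        Some (case delta S x \<sigma> of Some x' \<Rightarrow> Com x' | None \<Rightarrow> Detect)
      else None)"
| "bt_loop_delta \<Sigma>c \<Sigma>o \<Sigma>sA S (Exec x) (Hash \<sigma>) =
     (if x \<in> states S \<and> \<sigma> \<in> \<Sigma>sA
      then Some (case delta S x \<sigma> of Some x' \<Rightarrow> Com x' | None \<Rightarrow> Detect)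
      else None)"
| "bt_loop_delta \<Sigma>c \<Sigma>o \<Sigma>sA S Detect _ = None"

definition BT_attack_loop ::
  "'e set \<Rightarrow> 'e set \<Rightarrow> 'e set \<Rightarrow> ('x, 'e) automaton \<Rightarrow> ('x bt_state, 'e event) automaton" where
  "BT_attack_loop \<Sigma>c \<Sigma>o \<Sigma>sA S =
     \<lparr>states = Exec ` states S \<union> Com ` states S \<union> {Detect},
      alphabet = attack_alphabet (alphabet S) \<Sigma>c \<Sigma>sA,
      delta = bt_loop_delta \<Sigma>c \<Sigma>o \<Sigma>sA S,
      init = Com (init S),
      marked = Exec ` states S \<union> Com ` states S \<union> {Detect}\<rparr>"

end

theory Submission
  imports Defs
begin

text \<open>
  The observer state of the plant in closed loop with \<open>BT S\<close> is always empty or of the form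
  \<open>V \<times> {y}\<close>: the monitor sees every command and every event that moves \<open>BT S\<close>, so it knows the
  state \<open>y\<close> exactly. Sending a state \<open>(V, y)\<close> of the right-hand product to \<open>V \<times> {y}\<close>, and to the
  dead state \<open>{}\<close> if \<open>y\<close> is the detection state, is therefore a functional bisimulation.
\<close>

section \<open>Language equality from a functional bisimulation\<close>

text \<open>The step hypothesis equates options, so it transfers definedness in both directions
  together with the successor. As it is available only under \<open>I\<close>, the invariant has to
  be carried along the run.\<close>

lemma delta_star_functional_bisim:
  assumes step: "\<And>p e. I p \<Longrightarrow> delta A (f p) e = map_option f (delta B p e)"
    and inv: "\<And>p e p'. I p \<Longrightarrow> delta B p e = Some p' \<Longrightarrow> I p'"
    and "I p"
  shows "delta_star A (f p) s = map_option f (delta_star B p s)"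
  using \<open>I p\<close>
proof (induction s arbitrary: p)
  case (Cons e s)
  then show ?case
    using step[of p e] inv[of p e] by (cases "delta B p e") auto
qed simp

lemma closed_behavior_functional_bisim:
  assumes "\<And>p e. I p \<Longrightarrow> delta A (f p) e = map_option f (delta B p e)"
    and "\<And>p e p'. I p \<Longrightarrow> delta B p e = Some p' \<Longrightarrow> I p'"
    and "I (init B)" and "init A = f (init B)" and "alphabet A = alphabet B"
  shows "closed_behavior A = closed_behavior B"
  using assms(4,5) delta_star_functional_bisim[of I A f B, OF assms(1-3)]
  by (simp add: closed_behavior_def)

section \<open>Closure properties of plant and supervisor\<close>

locale supervised_plant =
  fixes G :: "('q, 'e) automaton"
    and S :: "('x, 'e) automaton"
    and \<Sigma>c \<Sigma>o \<Sigma>sA :: "'e set"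
  assumes plant: "finite_automaton G"
    and obs_subset: "\<Sigma>o \<subseteq> alphabet G"
    and sup: "supervisor (alphabet G) \<Sigma>c \<Sigma>o S"
    and attack_subset: "\<Sigma>sA \<subseteq> \<Sigma>o"
begin

abbreviation "closed_loop \<equiv> sync_prod (embed G) (BT \<Sigma>c \<Sigma>o S)"

abbreviation "attacked_product \<equiv>
  sync_prod (relabelled_abstraction \<Sigma>c \<Sigma>o \<Sigma>sA G) (BT_attack_loop \<Sigma>c \<Sigma>o \<Sigma>sA S)"

lemma alphabet_S: "alphabet S = alphabet G"
  using sup by (simp add: supervisor_def)

lemma delta_G_closed:
  "delta G q \<sigma> = Some q' \<Longrightarrow> q \<in> states G \<and> \<sigma> \<in> alphabet G \<and> q' \<in> states G"
  using plant by (simp add: finite_automaton_def)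

lemma delta_S_closed:
  "delta S x \<sigma> = Some x' \<Longrightarrow> x \<in> states S \<and> \<sigma> \<in> alphabet G \<and> x' \<in> states S"
  using sup unfolding supervisor_def finite_automaton_def by metis

lemma delta_star_G_closed:
  "delta_star G q s = Some q' \<Longrightarrow> q \<in> states G \<Longrightarrow> q' \<in> states G"
  by (induction s arbitrary: q) (auto split: option.splits dest: delta_G_closed)

lemma delta_set_closed: "delta_set G V \<sigma> \<subseteq> states G"
  by (auto simp: delta_set_def dest: delta_G_closed)

lemma unobs_reach_set_closed: "V \<subseteq> states G \<Longrightarrow> unobs_reach_set G U V \<subseteq> states G"
  by (auto simp: unobs_reach_set_def unobs_reach_def dest: delta_star_G_closed)

lemma delta_S_unobservable:
  "x \<in> states S \<Longrightarrow> \<sigma> \<in> alphabet G - \<Sigma>o \<Longrightarrow> \<sigma> \<in> enabled S x \<Longrightarrow> delta S x \<sigma> = Some x"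
  using sup by (auto simp: supervisor_def enabled_def)

text \<open>Uncontrollable events are defined at every supervisor state. This puts the command
  issued at \<open>x\<close> into the alphabet of \<open>BT\<close>, so the product can execute
  it.\<close>

lemma enabled_control_command:
  "x \<in> states S \<Longrightarrow> enabled S x \<in> control_commands (alphabet G) \<Sigma>c"
  using sup by (auto simp: supervisor_def enabled_def control_commands_def)

section \<open>Transitions of the closed loop\<close>

lemma unobservable_events:
  "alphabet closed_loop - (Ev ` \<Sigma>o \<union> Cmd ` control_commands (alphabet G) \<Sigma>c)
   = Ev ` (alphabet G - \<Sigma>o)"
  by (auto simp: sync_prod_def embed_def BT_def alphabet_S)

text \<open>Plant events are shared, so both components must move. \<open>Com x\<close> waits for a
  command and blocks all of them.\<close>

lemma delta_closed_loop_Ev: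
  assumes "q \<in> states G" "x \<in> states S"
  shows "delta closed_loop (q, Exec x) (Ev \<sigma>) =
    (case (delta G q \<sigma>, delta S x \<sigma>) of
       (Some q', Some x') \<Rightarrow> Some (q', if \<sigma> \<in> \<Sigma>o then Com x' else Exec x')
     | _ \<Rightarrow> None)"
    and "delta closed_loop (q, Com x) (Ev \<sigma>) = None"
  using assms
  by (auto simp: sync_prod_def embed_def BT_def alphabet_S split: option.splits
      dest: delta_G_closed)

lemma delta_closed_loop_Cmd:
  assumes "q \<in> states G" "x \<in> states S"
  shows "delta closed_loop (q, Com x) (Cmd \<gamma>) =
      (if \<gamma> = enabled S x then Some (q, Exec x) else None)"
    and "delta closed_loop (q, Exec x) (Cmd \<gamma>) = None"
  using assms enabled_control_command
  by (auto simp: sync_prod_def embed_def BT_def alphabet_S)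

section \<open>Unobservable reach in the closed loop\<close>

text \<open>An enabled unobservable event is a self-loop of the supervisor, so \<open>Exec x\<close>
  never changes along \<open>s\<close>; the supervisor acts only as a filter that stops the plant at
  the first disabled event.\<close>

lemma delta_star_closed_loop_Exec:
  assumes "q \<in> states G" "x \<in> states S" "s \<in> lists (alphabet G - \<Sigma>o)"
  shows "delta_star closed_loop (q, Exec x) (map Ev s) =
    (if set s \<subseteq> enabled S x then map_option (\<lambda>q'. (q', Exec x)) (delta_star G q s) else None)"
  using assms
proof (induction s arbitrary: q)
  case (Cons \<sigma> s)
  show ?case
  proof (cases "\<sigma> \<in> enabled S x")
    case True
    then have "delta S x \<sigma> = Some x"
      using Cons.prems by (auto intro: delta_S_unobservable)
    then have "delta_star closed_loop (q, Exec x) (map Ev (\<sigma> # s)) =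
        (case delta G q \<sigma> of None \<Rightarrow> None
         | Some q' \<Rightarrow> delta_star closed_loop (q', Exec x) (map Ev s))"
      using Cons.prems by (simp add: delta_closed_loop_Ev split: option.split)
    then show ?thesis
      using Cons True by (cases "delta G q \<sigma>") (simp_all add: delta_G_closed)
  next
    case False
    then have "delta S x \<sigma> = None"
      using Cons.prems by (auto simp: enabled_def alphabet_S)
    then show ?thesis
      using Cons.prems False by (auto simp: delta_closed_loop_Ev split: option.splits)
  qed
qed simp

text \<open>The event set on the right is exactly the one over which the abstraction closes when it
  reads the command \<open>enabled S x\<close>; here the two constructions meet.\<close>

lemma unobs_reach_closed_loop_Exec:
  assumes "q \<in> states G" "x \<in> states S"
  shows "unobs_reach closed_loop (Ev ` (alphabet G - \<Sigma>o)) (q, Exec x) =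
    unobs_reach G (enabled S x \<inter> (alphabet G - \<Sigma>o)) q \<times> {Exec x}"
proof -
  have "unobs_reach closed_loop (Ev ` (alphabet G - \<Sigma>o)) (q, Exec x) =
    {p. \<exists>s\<in>lists (alphabet G - \<Sigma>o). delta_star closed_loop (q, Exec x) (map Ev s) = Some p}"
    by (auto simp: unobs_reach_def lists_image)
  also have "\<dots> = {p. \<exists>s\<in>lists (alphabet G - \<Sigma>o). set s \<subseteq> enabled S x \<and>
      map_option (\<lambda>q'. (q', Exec x)) (delta_star G q s) = Some p}"
    using delta_star_closed_loop_Exec[OF assms] by (auto split: if_splits)
  also have "\<dots> = unobs_reach G (enabled S x \<inter> (alphabet G - \<Sigma>o)) q \<times> {Exec x}"
    by (fastforce simp: unobs_reach_def lists_eq_set)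
  finally show ?thesis .
qed

text \<open>No plant event is defined at \<open>Com x\<close>, so only the empty string
  contributes.\<close>

lemma unobs_reach_closed_loop_Com:
  assumes "q \<in> states G" "x \<in> states S"
  shows "unobs_reach closed_loop (Ev ` (alphabet G - \<Sigma>o)) (q, Com x) = {(q, Com x)}"
proof -
  have "p = (q, Com x)"
    if "s \<in> lists (Ev ` (alphabet G - \<Sigma>o))" "delta_star closed_loop (q, Com x) s = Some p" for s p
    using that assms by (cases s) (auto simp: delta_closed_loop_Ev)
  moreover have "delta_star closed_loop (q, Com x) [] = Some (q, Com x)"
    by simp
  ultimately show ?thesis
    unfolding unobs_reach_def by blast
qed

lemma unobs_reach_set_closed_loop:
  assumes "V \<subseteq> states G" "x \<in> states S"
  shows "unobs_reach_set closed_loop (Ev ` (alphabet G - \<Sigma>o)) (V \<times> {Exec x}) =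
      unobs_reach_set G (enabled S x \<inter> (alphabet G - \<Sigma>o)) V \<times> {Exec x}"
    and "unobs_reach_set closed_loop (Ev ` (alphabet G - \<Sigma>o)) (V \<times> {Com x}) = V \<times> {Com x}"
proof -
  \<comment> \<open>With the second component fixed, the union over pairs becomes a union over
    \<open>V\<close>, to which the pointwise results apply.\<close>
  have pairs: "unobs_reach_set closed_loop U (V \<times> {z}) = (\<Union>q\<in>V. unobs_reach closed_loop U (q, z))"
    for U z
    by (auto simp: unobs_reach_set_def)
  have V: "q \<in> V \<Longrightarrow> q \<in> states G" for q
    using assms by blast
  show "unobs_reach_set closed_loop (Ev ` (alphabet G - \<Sigma>o)) (V \<times> {Exec x}) =
      unobs_reach_set G (enabled S x \<inter> (alphabet G - \<Sigma>o)) V \<times> {Exec x}"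
    unfolding pairs
    by (auto simp: unobs_reach_closed_loop_Exec[OF V assms(2)] unobs_reach_set_def)
  show "unobs_reach_set closed_loop (Ev ` (alphabet G - \<Sigma>o)) (V \<times> {Com x}) = V \<times> {Com x}"
    unfolding pairs
    by (auto simp: unobs_reach_closed_loop_Com[OF V assms(2)])
qed

text \<open>All pairs share the state of \<open>BT\<close>, so a move refused there empties the
  whole set. These empty results are the counterpart of the transitions into
  \<open>Detect\<close>.\<close>

lemma delta_set_closed_loop:
  assumes "V \<subseteq> states G" "x \<in> states S"
  shows "\<sigma> \<in> \<Sigma>o \<Longrightarrow> delta_set closed_loop (V \<times> {Exec x}) (Ev \<sigma>) =
      (case delta S x \<sigma> of Some x' \<Rightarrow> delta_set G V \<sigma> \<times> {Com x'} | None \<Rightarrow> {})"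
    and "delta_set closed_loop (V \<times> {Com x}) (Ev \<sigma>) = {}"
    and "delta_set closed_loop (V \<times> {Com x}) (Cmd \<gamma>) =
      (if \<gamma> = enabled S x then V \<times> {Exec x} else {})"
    and "delta_set closed_loop (V \<times> {Exec x}) (Cmd \<gamma>) = {}"
proof -
  have V: "q \<in> V \<Longrightarrow> q \<in> states G" for q
    using assms by blast
  note simps = delta_set_def delta_closed_loop_Ev[OF V assms(2)] delta_closed_loop_Cmd[OF V assms(2)]
  show "\<sigma> \<in> \<Sigma>o \<Longrightarrow> delta_set closed_loop (V \<times> {Exec x}) (Ev \<sigma>) =
      (case delta S x \<sigma> of Some x' \<Rightarrow> delta_set G V \<sigma> \<times> {Com x'} | None \<Rightarrow> {})"
    by (fastforce simp: simps split: option.splits)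
  show "delta_set closed_loop (V \<times> {Com x}) (Ev \<sigma>) = {}"
    and "delta_set closed_loop (V \<times> {Com x}) (Cmd \<gamma>) =
      (if \<gamma> = enabled S x then V \<times> {Exec x} else {})"
    and "delta_set closed_loop (V \<times> {Exec x}) (Cmd \<gamma>) = {}"
    by (auto simp: simps)
qed

section \<open>Transitions of the monitor and the attacked monitor\<close>

lemma monitor_simps:
  "states (monitor \<Sigma>c \<Sigma>o G S) = Pow (states G \<times> (Exec ` states S \<union> Com ` states S))"
  "delta (monitor \<Sigma>c \<Sigma>o G S) D e =
    (if D = {} \<or> \<not> D \<subseteq> states G \<times> (Exec ` states S \<union> Com ` states S)
        \<or> e \<notin> Ev ` alphabet G \<union> Cmd ` control_commands (alphabet G) \<Sigma>c then None
     else if e \<in> Ev ` \<Sigma>o \<union> Cmd ` control_commands (alphabet G) \<Sigma>c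
     then Some (unobs_reach_set closed_loop (Ev ` (alphabet G - \<Sigma>o)) (delta_set closed_loop D e))
     else Some D)"
proof -
  have "states closed_loop = states G \<times> (Exec ` states S \<union> Com ` states S)"
    "alphabet closed_loop = Ev ` alphabet G \<union> Cmd ` control_commands (alphabet G) \<Sigma>c"
    by (auto simp: sync_prod_def embed_def BT_def alphabet_S)
  then show "states (monitor \<Sigma>c \<Sigma>o G S) = Pow (states G \<times> (Exec ` states S \<union> Com ` states S))"
  "delta (monitor \<Sigma>c \<Sigma>o G S) D e =
    (if D = {} \<or> \<not> D \<subseteq> states G \<times> (Exec ` states S \<union> Com ` states S)
        \<or> e \<notin> Ev ` alphabet G \<union> Cmd ` control_commands (alphabet G) \<Sigma>c then None
     else if e \<in> Ev ` \<Sigma>o \<union> Cmd ` control_commands (alphabet G) \<Sigma>c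
     then Some (unobs_reach_set closed_loop (Ev ` (alphabet G - \<Sigma>o)) (delta_set closed_loop D e))
     else Some D)"
    using unobservable_events by (simp_all add: monitor_def observer_def)
qed

lemma monitor_product_state:
  assumes "V \<noteq> {}" "V \<subseteq> states G" "z \<in> Exec ` states S \<union> Com ` states S"
  shows "delta (monitor \<Sigma>c \<Sigma>o G S) (V \<times> {z}) e =
      (if e \<notin> Ev ` alphabet G \<union> Cmd ` control_commands (alphabet G) \<Sigma>c then None
       else if e \<in> Ev ` \<Sigma>o \<union> Cmd ` control_commands (alphabet G) \<Sigma>c
       then Some (unobs_reach_set closed_loop (Ev ` (alphabet G - \<Sigma>o))
         (delta_set closed_loop (V \<times> {z}) e))
       else Some (V \<times> {z}))"
    and "V \<times> {z} \<in> states (monitor \<Sigma>c \<Sigma>o G S)"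
proof -
  have "V \<times> {z} \<subseteq> states G \<times> (Exec ` states S \<union> Com ` states S)" "V \<times> {z} \<noteq> {}"
    using assms by blast+
  then show "delta (monitor \<Sigma>c \<Sigma>o G S) (V \<times> {z}) e =
      (if e \<notin> Ev ` alphabet G \<union> Cmd ` control_commands (alphabet G) \<Sigma>c then None
       else if e \<in> Ev ` \<Sigma>o \<union> Cmd ` control_commands (alphabet G) \<Sigma>c
       then Some (unobs_reach_set closed_loop (Ev ` (alphabet G - \<Sigma>o))
         (delta_set closed_loop (V \<times> {z}) e))
       else Some (V \<times> {z}))"
    and "V \<times> {z} \<in> states (monitor \<Sigma>c \<Sigma>o G S)"
    unfolding monitor_simps by simp_all
qed

lemma delta_attacked_monitor:
  "delta (attacked_monitor \<Sigma>c \<Sigma>o \<Sigma>sA G S) D (Ev \<sigma>) =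
    (if \<sigma> \<in> \<Sigma>sA then (if D \<in> states (monitor \<Sigma>c \<Sigma>o G S) \<and> D \<noteq> {} then Some D else None)
     else delta (monitor \<Sigma>c \<Sigma>o G S) D (Ev \<sigma>))"
  "delta (attacked_monitor \<Sigma>c \<Sigma>o \<Sigma>sA G S) D (Hash \<sigma>) =
    (if \<sigma> \<in> \<Sigma>sA then delta (monitor \<Sigma>c \<Sigma>o G S) D (Ev \<sigma>) else None)"
  "delta (attacked_monitor \<Sigma>c \<Sigma>o \<Sigma>sA G S) D (Cmd \<gamma>) = delta (monitor \<Sigma>c \<Sigma>o G S) D (Cmd \<gamma>)"
  by (simp_all add: attacked_monitor_def Let_def)

section \<open>The state correspondence\<close>

text \<open>The map is not injective: every pair with \<open>Detect\<close> or with an empty plant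
  estimate goes to \<open>{}\<close>. This is harmless, since all these states are dead.\<close>

fun belief :: "'q set \<times> 'x bt_state \<Rightarrow> ('q \<times> 'x bt_state) set" where
  "belief (V, Detect) = {}"
| "belief (V, Exec x) = V \<times> {Exec x}"
| "belief (V, Com x) = V \<times> {Com x}"

text \<open>This is membership in the carrier of the product, used as the invariant of the
  bisimulation. Empty estimates are included because they are reachable.\<close>

definition product_state :: "'q set \<times> 'x bt_state \<Rightarrow> bool" where
  "product_state p \<longleftrightarrow>
     fst p \<subseteq> states G \<and> snd p \<in> Exec ` states S \<union> Com ` states S \<union> {Detect}"

text \<open>Both factors have the same alphabet, so every event is synchronized and no interleaving
  case remains.\<close>

lemma delta_attacked_product:
  "delta attacked_product (V, y) e =
    (if \<not> product_state (V, y) \<or> e \<notin> attack_alphabet (alphabet G) \<Sigma>c \<Sigma>sA then None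
     else case (delta (relabelled_abstraction \<Sigma>c \<Sigma>o \<Sigma>sA G) V e, bt_loop_delta \<Sigma>c \<Sigma>o \<Sigma>sA S y e) of
       (Some V', Some y') \<Rightarrow> Some (V', y') | _ \<Rightarrow> None)"
  by (auto simp: product_state_def sync_prod_def relabelled_abstraction_def BT_attack_loop_def alphabet_S)

lemma delta_abstraction:
  "delta (relabelled_abstraction \<Sigma>c \<Sigma>o \<Sigma>sA G) V e =
    (if V = {} \<or> \<not> V \<subseteq> states G then None
     else case e of
         Cmd \<gamma> \<Rightarrow>
           if \<gamma> \<in> control_commands (alphabet G) \<Sigma>c
           then Some (unobs_reach_set G (\<gamma> \<inter> (alphabet G - \<Sigma>o)) V) else None
       | Ev \<sigma> \<Rightarrow>
           if \<sigma> \<in> \<Sigma>o - \<Sigma>sA then Some (delta_set G V \<sigma>)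
           else if \<sigma> \<in> \<Sigma>sA \<union> (alphabet G - \<Sigma>o) then Some V else None
       | Hash \<sigma> \<Rightarrow> if \<sigma> \<in> \<Sigma>sA then Some (delta_set G V \<sigma>) else None)"
  by (simp add: relabelled_abstraction_def)

lemma product_state_step:
  assumes "product_state p" "delta attacked_product p e = Some p'"
  shows "product_state p'"
proof -
  obtain V y V' y' where p: "p = (V, y)" "p' = (V', y')"
    by (metis surj_pair)
  have "delta (relabelled_abstraction \<Sigma>c \<Sigma>o \<Sigma>sA G) V e = Some V'"
    and y': "bt_loop_delta \<Sigma>c \<Sigma>o \<Sigma>sA S y e = Some y'"
    using assms(2) unfolding p delta_attacked_product by (auto split: if_splits option.splits)
  then have "V' \<subseteq> states G"
    using delta_set_closed
    by (cases e) (auto simp: delta_abstraction split: if_splits dest: subsetD[OF unobs_reach_set_closed])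
  moreover have "y' \<in> Exec ` states S \<union> Com ` states S \<union> {Detect}"
    using y' by (cases y; cases e) (auto split: if_splits option.splits dest: delta_S_closed)
  ultimately show ?thesis
    by (simp add: p product_state_def)
qed

lemma unobs_reach_set_empty [simp]: "unobs_reach_set A U {} = {}"
  by (simp add: unobs_reach_set_def)

lemma belief_step:
  assumes "product_state p"
  shows "delta (attacked_monitor \<Sigma>c \<Sigma>o \<Sigma>sA G S) (belief p) e =
    map_option belief (delta attacked_product p e)"
proof -
  obtain V y where p: "p = (V, y)"
    by (cases p)
  have V: "V \<subseteq> states G"
    using assms by (simp add: p product_state_def)
  have events: "\<sigma> \<in> \<Sigma>o \<Longrightarrow> \<sigma> \<in> alphabet G" "\<sigma> \<in> \<Sigma>sA \<Longrightarrow> \<sigma> \<in> \<Sigma>o" for \<sigma>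
    using obs_subset attack_subset by auto
  \<comment> \<open>The first case collects the dead states; the other two are told apart by whether
    \<open>BT\<close> awaits an event or a command.\<close>
  consider "V = {} \<or> y = Detect" | x where "V \<noteq> {}" "y = Exec x" "x \<in> states S"
    | x where "V \<noteq> {}" "y = Com x" "x \<in> states S"
    using assms by (auto simp: p product_state_def)
  then show ?thesis
  proof cases
    case 1
    then have "belief p = {}"
      by (cases y) (auto simp: p)
    moreover have "delta attacked_product p e = None"
      using 1 by (auto simp: p delta_attacked_product delta_abstraction split: option.splits)
    ultimately show ?thesis
      by (auto simp: attacked_monitor_def monitor_simps Let_def split: event.splits)
  next
    case (2 x)
    \<comment> \<open>An observable event leads to a \<open>Com\<close> state, where the closure
      adds nothing. This agrees with the abstraction, which takes a bare image and closes only at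
      the next command.\<close>
    have "unobs_reach_set closed_loop (Ev ` (alphabet G - \<Sigma>o)) (delta_set G V \<sigma> \<times> {Com x'})
        = delta_set G V \<sigma> \<times> {Com x'}" if "delta S x \<sigma> = Some x'" for \<sigma> x'
      using that delta_S_closed[OF that] delta_set_closed by (intro unobs_reach_set_closed_loop) auto
    \<comment> \<open>If the supervisor disables the event, the left side is empty, and so is the
      belief of any pair with \<open>Detect\<close>; one equation thus covers both outcomes.\<close>
    then have reach: "unobs_reach_set closed_loop (Ev ` (alphabet G - \<Sigma>o))
        (delta_set closed_loop (V \<times> {Exec x}) (Ev \<sigma>)) =
        belief (delta_set G V \<sigma>, case delta S x \<sigma> of Some x' \<Rightarrow> Com x' | None \<Rightarrow> Detect)"
      if "\<sigma> \<in> \<Sigma>o" for \<sigma>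
      using that V 2 by (simp add: delta_set_closed_loop split: option.split)
    have "V \<times> {Exec x} \<noteq> {}"
      using 2 by blast
    \<comment> \<open>Compromised and unobservable \<open>Ev\<close> events are self-loops on both
      sides, \<open>reach\<close> treats the remaining plant events and the \<open>Hash\<close>
      events, and every command empties the belief as it leads to \<open>Detect\<close>.\<close>
    then show ?thesis
      using 2 V assms
      by (cases e)
        (auto simp: p delta_attacked_monitor monitor_product_state events image_iff reach delta_attacked_product
          delta_abstraction attack_alphabet_def alphabet_S delta_set_closed_loop(4))
  next
    case (3 x)
    have "V \<times> {Com x} \<noteq> {}"
      using 3 by blast
    \<comment> \<open>Only the command \<open>enabled S x\<close> keeps the belief alive, and both
      sides then take the same unobservable closure. Any other command, uncompromised observable
      event or \<open>Hash\<close> event empties it, matching \<open>Detect\<close>.\<close>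
    then show ?thesis
      using 3 V assms enabled_control_command
      by (cases e)
        (auto simp: p delta_attacked_monitor monitor_product_state events image_iff delta_attacked_product
          delta_abstraction attack_alphabet_def alphabet_S delta_set_closed_loop
          unobs_reach_set_closed_loop)
  qed
qed

section \<open>Equality of the closed behaviors\<close>

theorem closed_behavior_attacked_monitor:
  "closed_behavior (attacked_monitor \<Sigma>c \<Sigma>o \<Sigma>sA G S) = closed_behavior attacked_product"
proof (rule closed_behavior_functional_bisim[where f = belief and I = product_state])
  have init: "init attacked_product = ({init G}, Com (init S))"
    by (simp add: sync_prod_def relabelled_abstraction_def BT_attack_loop_def)
  have "init G \<in> states G" "init S \<in> states S"
    using plant sup by (simp_all add: supervisor_def finite_automaton_def)
  then show "product_state (init attacked_product)"
    by (simp add: init product_state_def)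
  show "init (attacked_monitor \<Sigma>c \<Sigma>o \<Sigma>sA G S) = belief (init attacked_product)"
    by (simp add: init attacked_monitor_def Let_def)
  show "alphabet (attacked_monitor \<Sigma>c \<Sigma>o \<Sigma>sA G S) = alphabet attacked_product"
    by (simp add: sync_prod_def relabelled_abstraction_def BT_attack_loop_def attacked_monitor_def
        Let_def alphabet_S)
qed (fact belief_step, fact product_state_step)

end

theorem proposition1:
  fixes G :: "('q, 'e) automaton"
    and S :: "('x, 'e) automaton"
    and \<Sigma>c \<Sigma>o \<Sigma>sA :: "'e set"
  assumes "finite_automaton G"
    and "\<Sigma>c \<subseteq> alphabet G" and "\<Sigma>o \<subseteq> alphabet G"
    and "supervisor (alphabet G) \<Sigma>c \<Sigma>o S"
    and "\<Sigma>sA \<subseteq> \<Sigma>o"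
  shows "closed_behavior (attacked_monitor \<Sigma>c \<Sigma>o \<Sigma>sA G S) =
         closed_behavior (sync_prod (relabelled_abstraction \<Sigma>c \<Sigma>o \<Sigma>sA G)
                                    (BT_attack_loop \<Sigma>c \<Sigma>o \<Sigma>sA S))"
proof -
  interpret supervised_plant G S \<Sigma>c \<Sigma>o \<Sigma>sA
    using assms by unfold_locales
  show ?thesis
    by (rule closed_behavior_attacked_monitor)
qed

end
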